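(* Let $\mathcal{E}=\{(X,\mathcal{A},\mu);\ \mathbb{R}^n_+;\ e;\ \{\succ_a\}_{a\in X}\}$ be a pure exchange economy satisfying (E1)–(E4) of the context. Then every walrasian allocation belongs to the core, i.e. $W(\mathcal{E})\subset C(\mathcal{E})$.
   Context: Fuzzy measures. A fuzzy measure on a measurable space $(X,\mathcal{A})$ ($\mathcal{A}$ a $\sigma$-algebra) is a map $\mu:\mathcal{A}\to[0,\infty)$ with $\mu(\emptyset)=0$, $\mu(X)<\infty$ and $\mu(A)\le\mu(B)$ whenever $A\subset B$. It is submodular if $\mu(A\cup B)+\mu(A\cap B)\le\mu(A)+\mu(B)$ for all $A,B\in\mathcal{A}$. It is semiconvex if for every $E\in\mathcal{A}$ there is $F\in\mathcal{A}$, $F\subset E$, with $\mu(F)=\mu(E\setminus F)=\frac12\mu(E)$. A set $N\in\mathcal{A}$ is $\mu$-null if $\mu(A\cup N)=\mu(A)$ for every $A\in\mathcal{A}$; "$\mu$-a.e." means outside a $\mu$-null set. Choquet integral. For measurable $f:X\to[0,\infty)$, $\int_X^* f\,d\mu:=\int_0^\infty\mu(\{f>t\})\,dt$, and $f$ is (Choquet) integrable if this is finite. For $E\in\mathcal{A}$, $\mu_f(E)=\int_E^*f\,d\mu:=\int_X^*1_Ef\,d\mu$. For $f:X\to\mathbb{R}^n_+$ (the closed positive orthant), integrals and integrability are understood componentwise; $\mu_f(E)$ is then a vector. $(\mathbb{R}^n_+)^\circ$ is the interior of $\mathbb{R}^n_+$. Economy. (E1) $\mu$ is a semiconvex submodular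 fuzzy measure on $(X,\mathcal{A})$ such that a countable union of sets of $\mu$-measure zero has $\mu$-measure zero, and there is a finite measurable partition $\{E_1,\dots,E_r\}$ of $X$ with $\mu(A)=\sum_{i=1}^r\mu(A\cap E_i)$ for all $A\in\mathcal{A}$. (E2) The commodity space is $\mathbb{R}^n$ and the consumption set of each agent is $\mathbb{R}^n_+$. (E3) The initial endowment $e:X\to(\mathbb{R}^n_+)^\circ$ is constant on each $E_i$, $e(a)=e_i$ for $a\in E_i$, and $\mu_e(X)\in(\mathbb{R}^n_+)^\circ$. (E4) For each $i\le r$ there is a preference relation $\succ_i$ on $\mathbb{R}^n_+$, and $\succ_a=\succ_i$ for $a\in E_i$; each $\succ_i$ is (a) irreflexive and transitive; (b) monotone: $x+v\succ_i x$ for all $x\in\mathbb{R}^n_+$, $v\in\mathbb{R}^n_+\setminus\{0\}$; (c) continuous: for all $x\in(\mathbb{R}^n_+)^\circ$ the set $\{y\in\mathbb{R}^n_+: y\succeq_i x\}$ is closed, where $y\succeq_i x$ ("$y$ is at least as good as $x$") means that $x\succ_i y$ does not hold. Equilibrium notions. An allocation is an integrable $f:X\to\mathbb{R}^n_+$; it is feasible if $\mu_f(X)=\mu_e(X)$. A coalition is $S\in\mathcal{A}$ with $\mu(S)>0$. A coalition $S$ improves an allocation $f$ if there is an allocation $g$ with $g(a)\succ_a f(a)$ $\mu$-a.e. in $S$ and $\mu_g(S)=\mu_e(S)$. The core $C(\mathcal{E})$ is the set of feasible allocations that no coalition improves. A price is $p\in\mathbb{R}^n_+\setminus\{0\}$;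 the budget set of $a\in E_i$ is $B_p(a)=\{x\in\mathbb{R}^n_+:p\cdot x\le p\cdot e_i\}$. A feasible allocation $f$ is walrasian ($f\in W(\mathcal{E})$) if there is a price $p$ such that for $\mu$-almost all $a\in X$: $f(a)\in B_p(a)$, and $x\succ_a f(a)$ implies $p\cdot x>p\cdot e(a)$. *)

theory Defs
  imports "HOL-Analysis.Analysis"
begin

text \<open>
  A measurable space is given by a value \<open>M :: 'a measure\<close>, of which only
  \<open>space M\<close> and \<open>sets M\<close> are used; the measure carried by \<open>M\<close> plays no role. A set function
  \<open>\<mu> :: 'a set \<Rightarrow> real\<close> is only constrained, and only evaluated, on \<open>sets M\<close>.
\<close>

locale fuzzy_measure =
  fixes M :: "'a measure" and \<mu> :: "'a set \<Rightarrow> real"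
  assumes nonneg: "A \<in> sets M \<Longrightarrow> 0 \<le> \<mu> A"
    and empty: "\<mu> {} = 0"
    and mono: "\<lbrakk>A \<in> sets M; B \<in> sets M; A \<subseteq> B\<rbrakk> \<Longrightarrow> \<mu> A \<le> \<mu> B"

definition submodular :: "'a measure \<Rightarrow> ('a set \<Rightarrow> real) \<Rightarrow> bool" where
  "submodular M \<mu> \<longleftrightarrow>
     (\<forall>A\<in>sets M. \<forall>B\<in>sets M. \<mu> (A \<union> B) + \<mu> (A \<inter> B) \<le> \<mu> A + \<mu> B)"

definition semiconvex :: "'a measure \<Rightarrow> ('a set \<Rightarrow> real) \<Rightarrow> bool" where
  "semiconvex M \<mu> \<longleftrightarrow>
     (\<forall>E\<in>sets M. \<exists>F\<in>sets M. F \<subseteq> E \<and> \<mu> F = \<mu> E / 2 \<and> \<mu> (E - F) = \<mu> E / 2)"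

text \<open>Being null is in general stronger than having \<open>\<mu>\<close>-measure zero.\<close>

definition fuzzy_null :: "'a measure \<Rightarrow> ('a set \<Rightarrow> real) \<Rightarrow> 'a set \<Rightarrow> bool" where
  "fuzzy_null M \<mu> N \<longleftrightarrow> N \<in> sets M \<and> (\<forall>A\<in>sets M. \<mu> (A \<union> N) = \<mu> A)"

definition ae_in :: "'a measure \<Rightarrow> ('a set \<Rightarrow> real) \<Rightarrow> 'a set \<Rightarrow> ('a \<Rightarrow> bool) \<Rightarrow> bool" where
  "ae_in M \<mu> S P \<longleftrightarrow> (\<exists>N. fuzzy_null M \<mu> N \<and> (\<forall>a\<in>S - N. P a))"

definition choquet :: "'a measure \<Rightarrow> ('a set \<Rightarrow> real) \<Rightarrow> ('a \<Rightarrow> real) \<Rightarrow> ennreal" where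
  "choquet M \<mu> f = (\<integral>\<^sup>+ t\<in>{0..}. ennreal (\<mu> {a \<in> space M. f a > t}) \<partial>lborel)"

definition nonneg_orthant :: "(real ^ 'n) set" where
  "nonneg_orthant = {x. \<forall>j. 0 \<le> x $ j}"

definition choquet_integrable ::
    "'a measure \<Rightarrow> ('a set \<Rightarrow> real) \<Rightarrow> ('a \<Rightarrow> real ^ 'n) \<Rightarrow> bool" where
  "choquet_integrable M \<mu> f \<longleftrightarrow>
     f \<in> borel_measurable M \<and> (\<forall>j. choquet M \<mu> (\<lambda>a. f a $ j) < \<infinity>)"

text \<open>
  The vector \<open>\<mu>\<^sub>f(E)\<close>. It is meaningful for integrable \<open>f\<close> with values in the orthant: the
  Choquet integrals below are then finite, and \<open>enn2real\<close> loses nothing.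
\<close>

definition choquet_on ::
    "'a measure \<Rightarrow> ('a set \<Rightarrow> real) \<Rightarrow> ('a \<Rightarrow> real ^ 'n) \<Rightarrow> 'a set \<Rightarrow> real ^ 'n" where
  "choquet_on M \<mu> f E = (\<chi> j. enn2real (choquet M \<mu> (\<lambda>a. indicator E a * f a $ j)))"

text \<open>
  \<open>E 1, \<dots>, E r\<close> are the parts of the partition, \<open>c i\<close> and \<open>pref i\<close> the endowment and preference
  of the agents in \<open>E i\<close>; \<open>e a\<close> and \<open>better a\<close> are those of agent \<open>a\<close>. \<open>better a y x\<close> reads
  \<open>y \<succ>\<^sub>a x\<close>. Preferences are relations on the orthant only.
\<close>

locale exchange_economy = fuzzy_measure M \<mu>
  for M :: "'a measure" and \<mu> :: "'a set \<Rightarrow> real" +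
  fixes r :: nat and E :: "nat \<Rightarrow> 'a set"
    and c :: "nat \<Rightarrow> real ^ 'n" and pref :: "nat \<Rightarrow> real ^ 'n \<Rightarrow> real ^ 'n \<Rightarrow> bool"
    and e :: "'a \<Rightarrow> real ^ 'n" and better :: "'a \<Rightarrow> real ^ 'n \<Rightarrow> real ^ 'n \<Rightarrow> bool"
  assumes submodular: "submodular M \<mu>"
    and semiconvex: "semiconvex M \<mu>"
    and countable_union_zero:
      "\<And>N :: nat \<Rightarrow> 'a set. (\<And>k. N k \<in> sets M \<and> \<mu> (N k) = 0) \<Longrightarrow> \<mu> (\<Union>k. N k) = 0"
    and parts_measurable: "\<And>i. i \<in> {1..r} \<Longrightarrow> E i \<in> sets M"
    and parts_disjoint: "disjoint_family_on E {1..r}"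
    and parts_cover: "(\<Union>i\<in>{1..r}. E i) = space M"
    and additive_on_parts: "\<And>A. A \<in> sets M \<Longrightarrow> \<mu> A = (\<Sum>i=1..r. \<mu> (A \<inter> E i))"
    and endowment_interior: "\<And>a. a \<in> space M \<Longrightarrow> e a \<in> interior nonneg_orthant"
    and endowment_const: "\<And>i a. \<lbrakk>i \<in> {1..r}; a \<in> E i\<rbrakk> \<Longrightarrow> e a = c i"
    and total_endowment_interior: "choquet_on M \<mu> e (space M) \<in> interior nonneg_orthant"
    and better_const:
      "\<And>i a x y. \<lbrakk>i \<in> {1..r}; a \<in> E i; x \<in> nonneg_orthant; y \<in> nonneg_orthant\<rbrakk>
        \<Longrightarrow> better a y x \<longleftrightarrow> pref i y x"
    and pref_irrefl: "\<And>i. i \<in> {1..r} \<Longrightarrow> irreflp_on nonneg_orthant (pref i)"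
    and pref_trans: "\<And>i. i \<in> {1..r} \<Longrightarrow> transp_on nonneg_orthant (pref i)"
    and pref_monotone:
      "\<And>i x v. \<lbrakk>i \<in> {1..r}; x \<in> nonneg_orthant; v \<in> nonneg_orthant - {0}\<rbrakk> \<Longrightarrow> pref i (x + v) x"
    and pref_continuous:
      "\<And>i x. \<lbrakk>i \<in> {1..r}; x \<in> interior nonneg_orthant\<rbrakk>
        \<Longrightarrow> closed {y \<in> nonneg_orthant. \<not> pref i x y}"

definition allocation ::
    "'a measure \<Rightarrow> ('a set \<Rightarrow> real) \<Rightarrow> ('a \<Rightarrow> real ^ 'n) \<Rightarrow> bool" where
  "allocation M \<mu> f \<longleftrightarrow> f \<in> space M \<rightarrow> nonneg_orthant \<and> choquet_integrable M \<mu> f"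

definition feasible ::
    "'a measure \<Rightarrow> ('a set \<Rightarrow> real) \<Rightarrow> ('a \<Rightarrow> real ^ 'n) \<Rightarrow> ('a \<Rightarrow> real ^ 'n) \<Rightarrow> bool" where
  "feasible M \<mu> e f \<longleftrightarrow> choquet_on M \<mu> f (space M) = choquet_on M \<mu> e (space M)"

definition coalition :: "'a measure \<Rightarrow> ('a set \<Rightarrow> real) \<Rightarrow> 'a set \<Rightarrow> bool" where
  "coalition M \<mu> S \<longleftrightarrow> S \<in> sets M \<and> \<mu> S > 0"

definition improves ::
    "'a measure \<Rightarrow> ('a set \<Rightarrow> real) \<Rightarrow> ('a \<Rightarrow> real ^ 'n) \<Rightarrow>
     ('a \<Rightarrow> real ^ 'n \<Rightarrow> real ^ 'n \<Rightarrow> bool) \<Rightarrow> 'a set \<Rightarrow> ('a \<Rightarrow> real ^ 'n) \<Rightarrow> bool" where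
  "improves M \<mu> e better S f \<longleftrightarrow>
     (\<exists>g. allocation M \<mu> g \<and> ae_in M \<mu> S (\<lambda>a. better a (g a) (f a)) \<and>
          choquet_on M \<mu> g S = choquet_on M \<mu> e S)"

definition core ::
    "'a measure \<Rightarrow> ('a set \<Rightarrow> real) \<Rightarrow> ('a \<Rightarrow> real ^ 'n) \<Rightarrow>
     ('a \<Rightarrow> real ^ 'n \<Rightarrow> real ^ 'n \<Rightarrow> bool) \<Rightarrow> ('a \<Rightarrow> real ^ 'n) set" where
  "core M \<mu> e better =
     {f. allocation M \<mu> f \<and> feasible M \<mu> e f \<and>
         \<not> (\<exists>S. coalition M \<mu> S \<and> improves M \<mu> e better S f)}"

definition price :: "real ^ 'n \<Rightarrow> bool" where
  "price p \<longleftrightarrow> p \<in> nonneg_orthant - {0}"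

definition budget_set :: "('a \<Rightarrow> real ^ 'n) \<Rightarrow> real ^ 'n \<Rightarrow> 'a \<Rightarrow> (real ^ 'n) set" where
  "budget_set e p a = {x \<in> nonneg_orthant. p \<bullet> x \<le> p \<bullet> e a}"

definition walrasian ::
    "'a measure \<Rightarrow> ('a set \<Rightarrow> real) \<Rightarrow> ('a \<Rightarrow> real ^ 'n) \<Rightarrow>
     ('a \<Rightarrow> real ^ 'n \<Rightarrow> real ^ 'n \<Rightarrow> bool) \<Rightarrow> ('a \<Rightarrow> real ^ 'n) set" where
  "walrasian M \<mu> e better =
     {f. allocation M \<mu> f \<and> feasible M \<mu> e f \<and>
         (\<exists>p. price p \<and>
            ae_in M \<mu> (space M) (\<lambda>a. f a \<in> budget_set e p a \<and>
              (\<forall>x\<in>nonneg_orthant. better a x (f a) \<longrightarrow> p \<bullet> x > p \<bullet> e a)))}"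

end

theory Submission
  imports Defs
begin

text \<open>
  Suppose that a coalition \<open>S\<close> improves a walrasian allocation through \<open>g\<close>. Then
  \<open>p \<bullet> g > p \<bullet> e\<close> almost everywhere on \<open>S\<close>, and since countable unions of sets of measure zero
  have measure zero, \<open>p \<bullet> g > p \<bullet> e + \<delta>\<close> on some \<open>B \<subseteq> S\<close> with \<open>\<mu> B > 0\<close>. The endowment is constant
  on the parts, over which \<open>\<mu>\<close> is additive, so \<open>p \<bullet> \<mu>\<^sub>e(S) = (\<Sum>i. (p \<bullet> c i) * \<mu> (S \<inter> E i))\<close>.
  Submodularity yields \<open>p \<bullet> \<mu>\<^sub>g(S) \<ge> p \<bullet> \<mu>\<^sub>e(S) + \<delta> * \<mu> B\<close>, contradicting \<open>\<mu>\<^sub>g(S) = \<mu>\<^sub>e(S)\<close>: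
  up to an error of order \<open>\<epsilon>\<close>, \<open>p \<bullet> \<mu>\<^sub>g(S)\<close> is bounded below by \<open>\<epsilon>\<close> times the sum of the measures of the
  level sets \<open>{p $ j * g $ j > k * \<epsilon>}\<close>, and uncrossing these into the chain of the sets of
  points lying in at least \<open>s\<close> of them does not increase the sum.
\<close>

section \<open>Counting grid levels below a sum\<close>

lemma card_multiples_below:
  fixes h \<epsilon> :: real
  assumes "\<epsilon> > 0"
  shows "min (real K) (h / \<epsilon> - 1) \<le> real (card {k\<in>{1..K}. real k * \<epsilon> < h})"
proof -
  \<comment> \<open>The index of the last multiple of \<open>\<epsilon>\<close> strictly below
    \<open>h\<close>; strictness calls for the ceiling minus one, and \<open>nat\<close> yields 0
    when there is no such positive multiple.\<close>
  define m where "m = nat (\<lceil>h / \<epsilon>\<rceil> - 1)"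
  have "real k * \<epsilon> < h" if "k \<le> m" "1 \<le> k" for k
  proof -
    have "int k < \<lceil>h / \<epsilon>\<rceil>" using that unfolding m_def by linarith
    then have "real k < h / \<epsilon>" by (simp add: less_ceiling_iff)
    then show ?thesis using assms by (simp add: pos_less_divide_eq)
  qed
  then have "{1..min K m} \<subseteq> {k\<in>{1..K}. real k * \<epsilon> < h}" by auto
  then have "card {1..min K m} \<le> card {k\<in>{1..K}. real k * \<epsilon> < h}"
    by (intro card_mono) auto
  then have "min (real K) (real m) \<le> real (card {k\<in>{1..K}. real k * \<epsilon> < h})" by simp
  moreover have "h / \<epsilon> - 1 \<le> real m" unfolding m_def by linarith
  ultimately show ?thesis by linarith
qed

text \<open>Rounding costs at most one level per coordinate, hence the loss
  \<open>CARD('j)\<close>.\<close>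

lemma card_level_pairs:
  fixes h :: "'j::finite \<Rightarrow> real"
  assumes "\<epsilon> > 0" "v \<le> (\<Sum>j\<in>UNIV. h j)" "v / \<epsilon> \<le> real K"
  shows "v / \<epsilon> - real CARD('j) \<le> real (card {(j, k). k \<in> {1..K} \<and> real k * \<epsilon> < h j})"
proof -
  define n where "n j = card {k\<in>{1..K}. real k * \<epsilon> < h j}" for j
  have "{(j, k). k \<in> {1..K} \<and> real k * \<epsilon> < h j} = Sigma UNIV (\<lambda>j. {k\<in>{1..K}. real k * \<epsilon> < h j})"
    by auto
  then have card: "card {(j, k). k \<in> {1..K} \<and> real k * \<epsilon> < h j} = (\<Sum>j\<in>UNIV. n j)"
    by (simp add: n_def)
  have n: "min (real K) (h j / \<epsilon> - 1) \<le> real (n j)" for j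
    unfolding n_def by (rule card_multiples_below) fact
  have "v / \<epsilon> - real CARD('j) \<le> real (\<Sum>j\<in>UNIV. n j)"
  proof (cases "\<exists>j. real K \<le> real (n j)")
    \<comment> \<open>A coordinate that reaches the cutoff \<open>K\<close> supplies enough levels
      on its own.\<close>
    case True
    then obtain j where "real K \<le> real (n j)" by blast
    also have "n j \<le> (\<Sum>j\<in>UNIV. n j)" by (rule member_le_sum) auto
    finally show ?thesis using assms(3) by simp
  next
    case False
    have "v / \<epsilon> - real CARD('j) \<le> (\<Sum>j\<in>UNIV. h j) / \<epsilon> - real CARD('j)"
      using assms by (simp add: divide_right_mono)
    also have "\<dots> = (\<Sum>j\<in>UNIV. h j / \<epsilon> - 1)"
      by (simp add: sum_subtractf sum_divide_distrib)
    also have "\<dots> \<le> (\<Sum>j\<in>UNIV. real (n j))"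
    proof (rule sum_mono)
      fix j
      show "h j / \<epsilon> - 1 \<le> real (n j)"
        using n[of j] False by (metis min_def)
    qed
    finally show ?thesis by simp
  qed
  then show ?thesis by (simp only: card)
qed

section \<open>Uncrossing families of sets by submodularity\<close>

lemma sets_at_least:
  assumes "finite I" "\<And>l. l \<in> I \<Longrightarrow> A l \<in> sets M"
  shows "{a\<in>space M. s \<le> card {l\<in>I. a \<in> A l}} \<in> sets M"
proof -
  have "(\<Sum>l\<in>I. indicator (A l) a) = real (card {l\<in>I. a \<in> A l})" for a
    using assms(1) by (simp add: indicator_def sum.If_cases Int_def)
  then have "{a\<in>space M. s \<le> card {l\<in>I. a \<in> A l}}
      = {a\<in>space M. real s \<le> (\<Sum>l\<in>I. indicator (A l) a)}"
    by (simp only: of_nat_le_iff)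
  also have "\<dots> \<in> sets M"
  proof -
    have "(\<lambda>a. \<Sum>l\<in>I. indicator (A l) a :: real) \<in> borel_measurable M"
      using assms(2) by (intro borel_measurable_sum borel_measurable_indicator)
    then show ?thesis by measurable
  qed
  finally show ?thesis .
qed

context fuzzy_measure
begin

text \<open>Adding one set to the family changes each level of the chain by one union and one
  intersection. The submodular inequalities of the successive levels telescope.\<close>

lemma sum_at_least_le:
  assumes sub: "submodular M \<mu>" and "finite I" and "\<And>l. l \<in> I \<Longrightarrow> A l \<in> sets M"
  shows "(\<Sum>s=1..K. \<mu> {a\<in>space M. s \<le> card {l\<in>I. a \<in> A l}}) \<le> (\<Sum>l\<in>I. \<mu> (A l))"
  using assms(2,3)
proof (induction I arbitrary: K rule: finite_induct)
  case empty
  have "(\<Sum>s=1..K. \<mu> {a\<in>space M. s \<le> card {l\<in>{}. a \<in> A l}}) = 0"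
    by (rule sum.neutral) (simp add: fuzzy_measure.empty[OF fuzzy_measure_axioms])
  then show ?case by (simp only: sum.empty order_refl)
next
  case (insert l I)
  define C where "C s = {a\<in>space M. s \<le> card {l\<in>I. a \<in> A l}}" for s
  have C: "C s \<in> sets M" for s
    unfolding C_def using insert.hyps(1) insert.prems by (intro sets_at_least) auto
  have card: "card {l'\<in>insert l I. a \<in> A l'} = card {l\<in>I. a \<in> A l} + (if a \<in> A l then 1 else 0)" for a
  proof -
    have "{l'\<in>insert l I. a \<in> A l'} = (if a \<in> A l then insert l {l\<in>I. a \<in> A l} else {l\<in>I. a \<in> A l})"
      by auto
    then show ?thesis using insert.hyps by simp
  qed
  define C' where "C' s = {a\<in>space M. s \<le> card {l'\<in>insert l I. a \<in> A l'}}" for s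
  \<comment> \<open>A point lies in \<open>s + 1\<close> sets of the larger family if it already lay
    in that many, or if it lay in \<open>s\<close> of them and lies in the new set.\<close>
  have new: "C' (Suc s) = C (Suc s) \<union> (C s \<inter> A l)" for s
    unfolding C_def C'_def card by auto
  \<comment> \<open>The extra term on the left is the remainder of the telescoping. At
    \<open>K = 0\<close> it equals \<open>\<mu> (A l)\<close>, because \<open>C 0\<close> is the
    whole space; afterwards it is dropped by non-negativity.\<close>
  have "(\<Sum>s=1..K. \<mu> (C' s)) + \<mu> (C K \<inter> A l)
      \<le> (\<Sum>s=1..K. \<mu> (C s)) + \<mu> (A l)"
  proof (induction K)
    case 0
    have "A l \<subseteq> space M" using sets.sets_into_space insert.prems by auto
    then show ?case by (simp add: C_def Int_absorb1)
  next
    case (Suc K)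
    have "C (Suc K) \<subseteq> C K" by (auto simp: C_def)
    then have int: "C (Suc K) \<inter> (C K \<inter> A l) = C (Suc K) \<inter> A l" by auto
    \<comment> \<open>The union is the new level \<open>C' (Suc K)\<close>, the intersection the
      next remainder.\<close>
    have "\<mu> (C (Suc K) \<union> (C K \<inter> A l)) + \<mu> (C (Suc K) \<inter> A l) \<le> \<mu> (C (Suc K)) + \<mu> (C K \<inter> A l)"
      using sub C insert.prems unfolding submodular_def int[symmetric] by blast
    then show ?case using Suc.IH by (simp add: new)
  qed
  moreover have "0 \<le> \<mu> (C K \<inter> A l)" using C insert.prems by (intro nonneg) auto
  moreover have "(\<Sum>s=1..K. \<mu> (C s)) \<le> (\<Sum>l\<in>I. \<mu> (A l))"
    unfolding C_def using insert.prems by (intro insert.IH) auto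
  moreover have "(\<Sum>l'\<in>insert l I. \<mu> (A l')) = \<mu> (A l) + (\<Sum>l\<in>I. \<mu> (A l))"
    using insert.hyps by simp
  ultimately show ?case unfolding C'_def by linarith
qed

text \<open>The first \<open>q\<close> sets of the chain contain \<open>D\<close>, and the further
  ones up to \<open>q'\<close> contain \<open>B\<close>. Monotonicity bounds the chain from below,
  uncrossing bounds it from above.\<close>

lemma sum_covers_ge:
  assumes sub: "submodular M \<mu>" and I: "finite I" "\<And>l. l \<in> I \<Longrightarrow> A l \<in> sets M"
    and sets: "D \<in> sets M" "B \<in> sets M" "B \<subseteq> D" and le: "q \<le> q'"
    and D: "\<And>a. a \<in> D \<Longrightarrow> q \<le> card {l\<in>I. a \<in> A l}"
    and B: "\<And>a. a \<in> B \<Longrightarrow> q' \<le> card {l\<in>I. a \<in> A l}"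
  shows "real q * \<mu> D + (real q' - real q) * \<mu> B \<le> (\<Sum>l\<in>I. \<mu> (A l))"
proof -
  define C where "C s = {a\<in>space M. s \<le> card {l\<in>I. a \<in> A l}}" for s
  have C: "C s \<in> sets M" for s
    unfolding C_def using I by (rule sets_at_least)
  have split: "{1..q'} = {1..q} \<union> {q<..q'}" using le by auto
  have subD: "D \<subseteq> C s" if "s \<le> q" for s
    using sets.sets_into_space[OF sets(1)] le_trans[OF that D] unfolding C_def by blast
  have subB: "B \<subseteq> C s" if "s \<le> q'" for s
    using sets.sets_into_space[OF sets(2)] le_trans[OF that B] unfolding C_def by blast
  have "(\<Sum>s=1..q. \<mu> D) \<le> (\<Sum>s=1..q. \<mu> (C s))"
    by (intro sum_mono mono sets C subD) simp
  moreover have "(\<Sum>s\<in>{q<..q'}. \<mu> B) \<le> (\<Sum>s\<in>{q<..q'}. \<mu> (C s))"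
    by (intro sum_mono mono sets C subB) simp
  moreover have "(\<Sum>s=1..q'. \<mu> (C s)) = (\<Sum>s=1..q. \<mu> (C s)) + (\<Sum>s\<in>{q<..q'}. \<mu> (C s))"
    unfolding split by (rule sum.union_disjoint) auto
  moreover have "(\<Sum>s=1..q'. \<mu> (C s)) \<le> (\<Sum>l\<in>I. \<mu> (A l))"
    unfolding C_def using sub I by (rule sum_at_least_le)
  ultimately show ?thesis using le by (simp add: of_nat_diff)
qed

text \<open>The level sets cover \<open>D\<close> about \<open>w / \<epsilon>\<close> times and
  \<open>B\<close> about \<open>(w + \<delta>) / \<epsilon>\<close> times. In the error factor
  \<open>CARD('j) + 1\<close>, one unit per coordinate comes from the grid and the last one from
  rounding the multiplicity to an integer.\<close>

lemma sum_level_sets_ge: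
  fixes h :: "'j::finite \<Rightarrow> 'a \<Rightarrow> real"
  assumes sub: "submodular M \<mu>" and meas: "\<And>j. h j \<in> borel_measurable M"
    and sets: "D \<in> sets M" "B \<in> sets M" "B \<subseteq> D" and "\<epsilon> > 0" "\<delta> \<ge> 0"
    and D: "\<And>a. a \<in> D \<Longrightarrow> w \<le> (\<Sum>j\<in>UNIV. h j a)"
    and B: "\<And>a. a \<in> B \<Longrightarrow> w + \<delta> \<le> (\<Sum>j\<in>UNIV. h j a)"
    and K: "(w + \<delta>) / \<epsilon> \<le> real K"
  shows "(w - \<epsilon> * (real CARD('j) + 1)) * \<mu> D + \<delta> * \<mu> B
      \<le> \<epsilon> * (\<Sum>j\<in>UNIV. \<Sum>k=1..K. \<mu> {a\<in>D. real k * \<epsilon> < h j a})"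
proof -
  define n where "n = real CARD('j)"
  \<comment> \<open>The multiplicity of the cover guaranteed at points where the sum of the
    \<open>h j\<close> is at least \<open>v\<close>. If the count would be negative,
    \<open>nat\<close> makes it 0, which claims nothing.\<close>
  define q where "q v = nat \<lfloor>v / \<epsilon> - n\<rfloor>" for v
  define I where "I = (UNIV :: 'j set) \<times> {1..K}"
  define A where "A = (\<lambda>(j, k). {a\<in>D. real k * \<epsilon> < h j a})"
  have q: "v / \<epsilon> - n - 1 \<le> real (q v)" for v unfolding q_def by linarith
  have count: "q v \<le> card {l\<in>I. a \<in> A l}"
    if "a \<in> D" "v \<le> (\<Sum>j\<in>UNIV. h j a)" "v \<le> w + \<delta>" for a v
  proof -
    have "v / \<epsilon> \<le> (w + \<delta>) / \<epsilon>" using that \<open>\<epsilon> > 0\<close> by (simp add: divide_right_mono)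
    then have "v / \<epsilon> - n \<le> real (card {(j, k). k \<in> {1..K} \<and> real k * \<epsilon> < h j a})"
      unfolding n_def using that K \<open>\<epsilon> > 0\<close> by (intro card_level_pairs) auto
    also have "{(j, k). k \<in> {1..K} \<and> real k * \<epsilon> < h j a} = {l\<in>I. a \<in> A l}"
      using that by (auto simp: I_def A_def)
    finally show ?thesis unfolding q_def by linarith
  qed
  have le: "q w \<le> q (w + \<delta>)"
    unfolding q_def using assms by (intro nat_mono floor_mono) (simp add: divide_right_mono)
  have A: "A l \<in> sets M" for l
  proof -
    obtain j k where l: "l = (j, k)" by (cases l)
    have "{a\<in>D. real k * \<epsilon> < h j a} = D \<inter> {a\<in>space M. real k * \<epsilon> < h j a}"
      using sets.sets_into_space[OF sets(1)] by auto
    also have "\<dots> \<in> sets M" using meas[of j] sets(1) by measurable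
    finally show ?thesis by (simp add: A_def l)
  qed
  have main: "real (q w) * \<mu> D + (real (q (w + \<delta>)) - real (q w)) * \<mu> B \<le> (\<Sum>l\<in>I. \<mu> (A l))"
  proof (rule sum_covers_ge[OF sub _ A sets le])
    show "q w \<le> card {l\<in>I. a \<in> A l}" if "a \<in> D" for a
      using count[OF that, of w] D[OF that] \<open>\<delta> \<ge> 0\<close> by simp
    show "q (w + \<delta>) \<le> card {l\<in>I. a \<in> A l}" if "a \<in> B" for a
      using count[of a "w + \<delta>"] B[OF that] that sets by auto
  qed (simp add: I_def)
  have mu: "0 \<le> \<mu> B" "0 \<le> \<mu> D - \<mu> B" using nonneg mono sets by auto
  \<comment> \<open>In \<open>main\<close> the number \<open>q w\<close> occurs with both signs.
    Regrouping by the non-negative weights \<open>\<mu> D - \<mu> B\<close> and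
    \<open>\<mu> B\<close> allows both lower bounds on \<open>q\<close> to be inserted.\<close>
  have "(w / \<epsilon> - n - 1) * (\<mu> D - \<mu> B) + ((w + \<delta>) / \<epsilon> - n - 1) * \<mu> B
      \<le> real (q w) * (\<mu> D - \<mu> B) + real (q (w + \<delta>)) * \<mu> B"
    using q mu by (intro add_mono mult_right_mono) auto
  also have "\<dots> \<le> (\<Sum>l\<in>I. \<mu> (A l))" using main by (simp add: algebra_simps)
  finally have "\<epsilon> * ((w / \<epsilon> - n - 1) * (\<mu> D - \<mu> B) + ((w + \<delta>) / \<epsilon> - n - 1) * \<mu> B)
      \<le> \<epsilon> * (\<Sum>l\<in>I. \<mu> (A l))"
    using \<open>\<epsilon> > 0\<close> by simp
  moreover have "\<epsilon> * ((w / \<epsilon> - n - 1) * (\<mu> D - \<mu> B) + ((w + \<delta>) / \<epsilon> - n - 1) * \<mu> B)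
      = (w - \<epsilon> * (n + 1)) * \<mu> D + \<delta> * \<mu> B"
    using \<open>\<epsilon> > 0\<close> by (simp add: field_simps)
  moreover have "(\<Sum>l\<in>I. \<mu> (A l)) = (\<Sum>j\<in>UNIV. \<Sum>k=1..K. \<mu> {a\<in>D. real k * \<epsilon> < h j a})"
    by (simp add: I_def A_def sum.cartesian_product case_prod_unfold)
  ultimately show ?thesis by (simp add: n_def)
qed

section \<open>Choquet integrals and their lower sums\<close>

text \<open>The function \<open>t \<mapsto> \<mu> {f > t}\<close> is decreasing, so on each interval
  \<open>J k\<close> it is at least its value at the right endpoint: the sum is a lower Riemann sum
  with mesh \<open>s\<close>.\<close>

lemma choquet_ge_lower_sum:
  assumes f: "f \<in> borel_measurable M" and s: "s > 0"
  shows "ennreal (s * (\<Sum>k=1..K. \<mu> {a\<in>space M. real k * s < f a})) \<le> choquet M \<mu> f"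
proof -
  define J where "J k = {(real k - 1) * s..<real k * s}" for k :: nat
  define F where "F t = ennreal (\<mu> {a\<in>space M. f a > t})" for t
  have lev: "{a\<in>space M. f a > t} \<in> sets M" for t using f by measurable
  have disj: "disjoint_family_on J {1..K}"
  proof (unfold disjoint_family_on_def, intro ballI impI)
    have aux: "J k \<inter> J m = {}" if "k < m" for k m :: nat
    proof -
      have "real k * s \<le> (real m - 1) * s"
        using that s by (intro mult_right_mono) auto
      then show ?thesis by (auto simp: J_def)
    qed
    fix k m :: nat assume "k \<noteq> m"
    then show "J k \<inter> J m = {}" using aux[of k m] aux[of m k] by (auto simp: neq_iff)
  qed
  have J: "emeasure lborel (J k) = ennreal s" for k
    using s unfolding J_def by (subst emeasure_lborel_Ico) (auto simp: algebra_simps)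
  have "ennreal (s * (\<Sum>k=1..K. \<mu> {a\<in>space M. real k * s < f a}))
      = (\<Sum>k=1..K. F (real k * s) * emeasure lborel (J k))"
    using s lev nonneg
    by (simp add: J F_def sum_distrib_left ennreal_mult mult.commute flip: sum_ennreal)
  also have "\<dots> = (\<integral>\<^sup>+t. (\<Sum>k=1..K. F (real k * s) * indicator (J k) t) \<partial>lborel)"
    by (subst nn_integral_sum) (simp_all add: J_def nn_integral_cmult_indicator del: emeasure_lborel_Ico)
  also have "\<dots> \<le> (\<integral>\<^sup>+t. F t * indicator {0..} t \<partial>lborel)"
  proof (rule nn_integral_mono)
    fix t
    have "(\<Sum>k=1..K. F (real k * s) * indicator (J k) t) \<le> (\<Sum>k=1..K. F t * indicator (J k) t)"
    proof (rule sum_mono)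
      fix k
      show "F (real k * s) * indicator (J k) t \<le> F t * indicator (J k) t"
        using lev by (auto simp: F_def J_def split: split_indicator intro!: ennreal_leI mono)
    qed
    also have "\<dots> = F t * indicator (\<Union>k\<in>{1..K}. J k) t"
      by (simp only: indicator_UN_disjoint[OF finite_atLeastAtMost disj] sum_distrib_left)
    also have "\<dots> \<le> F t * indicator {0..} t"
    proof (rule mult_left_mono)
      have "(\<Union>k\<in>{1..K}. J k) \<subseteq> {0..}"
      proof clarsimp
        fix k x assume k: "Suc 0 \<le> k" "x \<in> J k"
        have "0 \<le> (real k - 1) * s" using k s by (intro mult_nonneg_nonneg) auto
        then show "0 \<le> x" using k by (auto simp: J_def)
      qed
      then show "(indicator (\<Union>k\<in>{1..K}. J k) t :: ennreal) \<le> indicator {0..} t"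
        by (auto split: split_indicator)
    qed simp
    finally show "(\<Sum>k=1..K. F (real k * s) * indicator (J k) t) \<le> F t * indicator {0..} t" .
  qed
  finally show ?thesis by (simp add: choquet_def F_def)
qed

text \<open>For \<open>p > 0\<close> the levels of \<open>p * f\<close> on the grid of mesh
  \<open>\<epsilon>\<close> are those of \<open>f\<close> on the grid of mesh
  \<open>\<epsilon> / p\<close>; for \<open>p = 0\<close> they are all empty.\<close>

lemma scaled_choquet_ge_lower_sum:
  assumes f: "f \<in> borel_measurable M" and fin: "choquet M \<mu> f < \<infinity>" and "\<epsilon> > 0" "p \<ge> 0"
  shows "\<epsilon> * (\<Sum>k=1..K. \<mu> {a\<in>space M. real k * \<epsilon> < p * f a}) \<le> p * enn2real (choquet M \<mu> f)"
proof (cases "p = 0")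
  case True
  have "{a\<in>space M. real k * \<epsilon> < p * f a} = {}" for k
    using True \<open>\<epsilon> > 0\<close> by (auto simp: not_less)
  then show ?thesis using True by (simp only: empty) simp
next
  case False
  with assms have p: "p > 0" by simp
  have eq: "{a\<in>space M. real k * (\<epsilon> / p) < f a} = {a\<in>space M. real k * \<epsilon> < p * f a}" for k
    using p by (auto simp: field_simps)
  have "ennreal (\<epsilon> / p * (\<Sum>k=1..K. \<mu> {a\<in>space M. real k * \<epsilon> < p * f a})) \<le> choquet M \<mu> f"
    using choquet_ge_lower_sum[OF f, of "\<epsilon> / p" K] p assms by (simp only: eq) simp
  also have "choquet M \<mu> f = ennreal (enn2real (choquet M \<mu> f))" using fin by simp
  finally have "\<epsilon> / p * (\<Sum>k=1..K. \<mu> {a\<in>space M. real k * \<epsilon> < p * f a}) \<le> enn2real (choquet M \<mu> f)"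
    using ennreal_le_iff[OF enn2real_nonneg] by blast
  then show ?thesis using p by (simp add: field_simps)
qed

lemma choquet_mono:
  assumes "f \<in> borel_measurable M" "g \<in> borel_measurable M" "\<And>a. a \<in> space M \<Longrightarrow> f a \<le> g a"
  shows "choquet M \<mu> f \<le> choquet M \<mu> g"
  unfolding choquet_def
proof (intro nn_integral_mono mult_right_mono ennreal_leI mono)
  fix t
  show "{a\<in>space M. t < f a} \<in> sets M" "{a\<in>space M. t < g a} \<in> sets M"
    using assms(1,2) by measurable
  show "{a\<in>space M. t < f a} \<subseteq> {a\<in>space M. t < g a}"
    using assms(3) by force
qed simp

section \<open>Null sets\<close>

lemma fuzzy_null_Un:
  assumes "fuzzy_null M \<mu> N" "fuzzy_null M \<mu> N'"
  shows "fuzzy_null M \<mu> (N \<union> N')"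
  using assms unfolding fuzzy_null_def by (metis Un_assoc sets.Un)

text \<open>Adding \<open>N\<close> to \<open>A - N\<close> leaves the measure unchanged and yields
  a superset of \<open>A\<close>.\<close>

lemma fuzzy_null_Diff:
  assumes "fuzzy_null M \<mu> N" "A \<in> sets M"
  shows "\<mu> (A - N) = \<mu> A"
proof -
  have N: "N \<in> sets M" and eq: "\<mu> ((A - N) \<union> N) = \<mu> (A - N)"
    using assms sets.Diff unfolding fuzzy_null_def by blast+
  have "\<mu> A \<le> \<mu> ((A - N) \<union> N)" "\<mu> (A - N) \<le> \<mu> A"
    using N assms by (auto intro!: mono)
  then show ?thesis using eq by linarith
qed

end

section \<open>The integral of the endowment\<close>

context exchange_economy
begin

lemma endowment_measurable: "e \<in> borel_measurable M"
proof (rule borel_measurableI)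
  fix U :: "(real ^ 'n) set"
  have "e -` U \<inter> space M = (\<Union>i\<in>{i\<in>{1..r}. c i \<in> U}. E i)"
    using endowment_const by (auto simp: parts_cover[symmetric])
  also have "\<dots> \<in> sets M" using parts_measurable by (intro sets.finite_UN) auto
  finally show "e -` U \<inter> space M \<in> sets M" .
qed

lemma endowment_pos:
  assumes "a \<in> space M"
  shows "0 \<le> e a $ j"
  using endowment_interior[OF assms] interior_subset[of nonneg_orthant]
  by (auto simp: nonneg_orthant_def)

text \<open>Since \<open>e\<close> is constant on each part and \<open>\<mu>\<close> is additive
  over the parts, the distribution function of the integrand is a sum of step functions, which is
  integrated term by term.\<close>

lemma choquet_endowment:
  assumes S: "S \<in> sets M"
  shows "choquet_on M \<mu> e S $ j = (\<Sum>i=1..r. c i $ j * \<mu> (S \<inter> E i))"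
proof -
  have SE: "S \<inter> E i \<in> sets M" if "i \<in> {1..r}" for i using S parts_measurable that by auto
  have level: "ennreal (\<mu> {a\<in>space M. t < indicator S a * e a $ j}) * indicator {0..} t
      = (\<Sum>i=1..r. ennreal (\<mu> (S \<inter> E i)) * indicator {0..<c i $ j} t)" for t
  proof (cases "t \<ge> 0")
    \<comment> \<open>For \<open>t \<ge> 0\<close> the points outside \<open>S\<close>, where the
      integrand is 0, stay out of the level set. For negative \<open>t\<close> the indicators make
      both sides vanish.\<close>
    case True
    define L where "L = {a\<in>space M. t < indicator S a * e a $ j}"
    have L: "L \<in> sets M"
      unfolding L_def using S measurable_compose[OF endowment_measurable borel_measurable_nth[of j]] by measurable
    have "L \<inter> E i = (if t < c i $ j then S \<inter> E i else {})" if i: "i \<in> {1..r}" for i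
      using True endowment_const[OF i] sets.sets_into_space[OF parts_measurable[OF i]]
      by (auto simp: L_def indicator_def split: if_splits)
    then have "\<mu> L = (\<Sum>i=1..r. if t < c i $ j then \<mu> (S \<inter> E i) else 0)"
      by (subst additive_on_parts[OF L]) (auto intro!: sum.cong simp: empty)
    also have "ennreal \<dots> = (\<Sum>i=1..r. ennreal (if t < c i $ j then \<mu> (S \<inter> E i) else 0))"
      using SE by (intro sum_ennreal[symmetric]) (auto simp: nonneg)
    also have "\<dots> = (\<Sum>i=1..r. ennreal (\<mu> (S \<inter> E i)) * indicator {0..<c i $ j} t)"
      using True by (intro sum.cong) (auto split: split_indicator)
    finally show ?thesis using True by (simp add: L_def)
  qed (auto split: split_indicator)
  have part: "ennreal (\<mu> (S \<inter> E i)) * emeasure lborel {0..<c i $ j} = ennreal (c i $ j * \<mu> (S \<inter> E i))"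
    and part_nonneg: "0 \<le> c i $ j * \<mu> (S \<inter> E i)" if i: "i \<in> {1..r}" for i
  proof -
    \<comment> \<open>The sign of \<open>c i\<close> is known only through an agent in
      \<open>E i\<close>. An empty part may carry any \<open>c i\<close>, but its measure is
      0.\<close>
    have "0 \<le> c i $ j \<or> \<mu> (S \<inter> E i) = 0"
    proof (cases "E i = {}")
      case False
      then obtain a where "a \<in> E i" by auto
      then have "0 \<le> c i $ j"
        using endowment_pos[of a j] endowment_const[OF i] sets.sets_into_space[OF parts_measurable[OF i]]
        by auto
      then show ?thesis ..
    qed (simp add: empty)
    then show "ennreal (\<mu> (S \<inter> E i)) * emeasure lborel {0..<c i $ j} = ennreal (c i $ j * \<mu> (S \<inter> E i))"
      and "0 \<le> c i $ j * \<mu> (S \<inter> E i)"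
      using nonneg[OF SE[OF i]] by (auto simp: ennreal_mult mult.commute)
  qed
  have "choquet M \<mu> (\<lambda>a. indicator S a * e a $ j)
      = (\<integral>\<^sup>+t. (\<Sum>i=1..r. ennreal (\<mu> (S \<inter> E i)) * indicator {0..<c i $ j} t) \<partial>lborel)"
    unfolding choquet_def level ..
  also have "\<dots> = (\<Sum>i=1..r. ennreal (\<mu> (S \<inter> E i)) * emeasure lborel {0..<c i $ j})"
    by (subst nn_integral_sum) (simp_all add: nn_integral_cmult_indicator)
  also have "\<dots> = (\<Sum>i=1..r. ennreal (c i $ j * \<mu> (S \<inter> E i)))"
    by (rule sum.cong) (use part in auto)
  also have "\<dots> = ennreal (\<Sum>i=1..r. c i $ j * \<mu> (S \<inter> E i))"
    by (rule sum_ennreal) (use part_nonneg in auto)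
  finally have "choquet M \<mu> (\<lambda>a. indicator S a * e a $ j) = ennreal (\<Sum>i=1..r. c i $ j * \<mu> (S \<inter> E i))" .
  moreover have "0 \<le> (\<Sum>i=1..r. c i $ j * \<mu> (S \<inter> E i))"
    by (rule sum_nonneg) (use part_nonneg in auto)
  ultimately show ?thesis by (simp add: choquet_on_def)
qed

section \<open>Strict comparison of the values of two integrals\<close>

text \<open>The gain \<open>\<delta> * \<mu> (B \<delta>)\<close> is fixed before the mesh
  \<open>\<epsilon>\<close> is chosen, so the discretisation error can be made smaller than the gain
  and the inequality stays strict.\<close>

lemma value_less_of_dominates:
  assumes g: "allocation M \<mu> g" and S: "coalition M \<mu> S" and p: "p \<in> nonneg_orthant"
    and dom: "ae_in M \<mu> S (\<lambda>a. p \<bullet> e a < p \<bullet> g a)"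
  shows "p \<bullet> choquet_on M \<mu> e S < p \<bullet> choquet_on M \<mu> g S"
proof -
  have SM: "S \<in> sets M" and Spos: "\<mu> S > 0" using S by (auto simp: coalition_def)
  have gM: "g \<in> borel_measurable M" using g by (auto simp: allocation_def choquet_integrable_def)
  have gMj: "(\<lambda>a. g a $ j) \<in> borel_measurable M" for j 
    using gM borel_measurable_nth by (rule measurable_compose)
  have gnn: "0 \<le> g a $ j" if "a \<in> space M" for a j
    using g that by (auto simp: allocation_def nonneg_orthant_def)
  have pnn: "0 \<le> p $ j" for j using p by (simp add: nonneg_orthant_def)
  have SE: "S \<inter> E i \<in> sets M" if "i \<in> {1..r}" for i using SM parts_measurable that by auto
  obtain N where N: "fuzzy_null M \<mu> N" and less: "\<And>a. a \<in> S - N \<Longrightarrow> p \<bullet> e a < p \<bullet> g a"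
    using dom by (auto simp: ae_in_def)
  have NM: "N \<in> sets M" using N by (simp add: fuzzy_null_def)
  define B where "B \<delta> = {a\<in>S - N. p \<bullet> e a + \<delta> \<le> p \<bullet> g a}" for \<delta>
  have BM: "B \<delta> \<in> sets M" for \<delta>
  proof -
    have "B \<delta> = (S - N) \<inter> {a\<in>space M. p \<bullet> e a + \<delta> \<le> p \<bullet> g a}"
      using sets.sets_into_space[OF SM] by (auto simp: B_def)
    also have "\<dots> \<in> sets M"
      using gM endowment_measurable SM NM by measurable
    finally show ?thesis .
  qed
  \<comment> \<open>The sets \<open>B (1 / (k + 1))\<close> exhaust \<open>S - N\<close>, whose
    measure is \<open>\<mu> S > 0\<close>, so they cannot all have measure zero. No continuity of
    \<open>\<mu>\<close> enters.\<close>
  obtain \<delta> where \<delta>: "\<delta> > 0" and Bpos: "\<mu> (B \<delta>) > 0"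
  proof (rule ccontr)
    assume neg: "\<not> thesis"
    have "\<mu> (B (inverse (real (Suc k)))) = 0" for k
      using neg that[of "inverse (real (Suc k))"] nonneg[OF BM[of "inverse (real (Suc k))"]] by force
    then have "\<mu> (\<Union>k. B (inverse (real (Suc k)))) = 0"
      using BM by (intro countable_union_zero) auto
    moreover have "(\<Union>k. B (inverse (real (Suc k)))) = S - N"
    proof (rule antisym)
      show "S - N \<subseteq> (\<Union>k. B (inverse (real (Suc k))))"
      proof
        fix a assume a: "a \<in> S - N"
        then have "0 < p \<bullet> g a - p \<bullet> e a" using less by simp
        then obtain k where "inverse (real (Suc k)) < p \<bullet> g a - p \<bullet> e a"
          using reals_Archimedean by blast
        then show "a \<in> (\<Union>k. B (inverse (real (Suc k))))"
          using a by (intro UN_I[of k]) (auto simp: B_def)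
      qed
    qed (auto simp: B_def)
    ultimately show False using fuzzy_null_Diff[OF N SM] Spos by simp
  qed
  define n where "n = real CARD('n)"
  \<comment> \<open>With this mesh the total error \<open>\<epsilon> * (n + 1) * \<mu> S\<close> is
    exactly half of the gain.\<close>
  define \<epsilon> where "\<epsilon> = \<delta> * \<mu> (B \<delta>) / (2 * (n + 1) * \<mu> S)"
  have npos: "n + 1 > 0" by (simp add: n_def add_nonneg_pos)
  have \<epsilon>: "\<epsilon> > 0" using \<delta> Bpos Spos npos by (simp add: \<epsilon>_def)
  \<comment> \<open>One number of levels that suffices for all parts at once.\<close>
  define K where "K = nat \<lceil>Max ((\<lambda>i. (p \<bullet> c i + \<delta>) / \<epsilon>) ` {1..r})\<rceil>"
  have K: "(p \<bullet> c i + \<delta>) / \<epsilon> \<le> real K" if "i \<in> {1..r}" for i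
  proof -
    have "(p \<bullet> c i + \<delta>) / \<epsilon> \<le> Max ((\<lambda>i. (p \<bullet> c i + \<delta>) / \<epsilon>) ` {1..r})"
      using that by (intro Max_ge) auto
    then show ?thesis unfolding K_def by linarith
  qed
  define L where "L j k = {a\<in>space M. real k * \<epsilon> < p $ j * (indicator S a * g a $ j)}" for j k
  have LM: "L j k \<in> sets M" for j k unfolding L_def using gMj[of j] SM by measurable
  have upper: "\<epsilon> * (\<Sum>k=1..K. \<mu> (L j k)) \<le> p $ j * choquet_on M \<mu> g S $ j" for j
  proof -
    have ind: "(\<lambda>a. indicator S a * g a $ j) \<in> borel_measurable M" using gMj[of j] SM by measurable
    \<comment> \<open>Finiteness on \<open>S\<close> is inherited from the integral over the whole
      space; \<open>enn2real\<close> would send an infinite value to 0.\<close>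
    have "choquet M \<mu> (\<lambda>a. indicator S a * g a $ j) \<le> choquet M \<mu> (\<lambda>a. g a $ j)"
      using gMj gnn by (intro choquet_mono ind) (auto split: split_indicator)
    also have "\<dots> < \<infinity>" using g by (auto simp: allocation_def choquet_integrable_def)
    finally show ?thesis
      unfolding L_def choquet_on_def using scaled_choquet_ge_lower_sum[OF ind _ \<epsilon> pnn] by simp
  qed
  \<comment> \<open>Within one part \<open>p \<bullet> e\<close> is the constant
    \<open>p \<bullet> c i\<close>, which serves as \<open>w\<close>. The estimate is made off
    \<open>N\<close>, where the strict inequality holds; restoring \<open>N\<close> does not change
    the measure.\<close>
  have lower: "(p \<bullet> c i - \<epsilon> * (n + 1)) * \<mu> (S \<inter> E i) + \<delta> * \<mu> (B \<delta> \<inter> E i)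
      \<le> \<epsilon> * (\<Sum>j\<in>UNIV. \<Sum>k=1..K. \<mu> (L j k \<inter> E i))" if i: "i \<in> {1..r}" for i
  proof -
    have DM: "S \<inter> E i - N \<in> sets M" and BEM: "B \<delta> \<inter> E i \<in> sets M"
      using SE[OF i] NM BM parts_measurable[OF i] by auto
    have inner: "p \<bullet> g a = (\<Sum>j\<in>UNIV. p $ j * g a $ j)" for a by (simp add: inner_vec_def)
    have "(p \<bullet> c i - \<epsilon> * (n + 1)) * \<mu> (S \<inter> E i - N) + \<delta> * \<mu> (B \<delta> \<inter> E i)
      \<le> \<epsilon> * (\<Sum>j\<in>UNIV. \<Sum>k=1..K. \<mu> {a\<in>S \<inter> E i - N. real k * \<epsilon> < p $ j * g a $ j})"
      unfolding n_def
    proof (rule sum_level_sets_ge[OF submodular _ DM BEM _ \<epsilon> _ _ _ K[OF i]])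
      show "(\<lambda>a. p $ j * g a $ j) \<in> borel_measurable M" for j using gMj[of j] by measurable
      show "p \<bullet> c i \<le> (\<Sum>j\<in>UNIV. p $ j * g a $ j)" if "a \<in> S \<inter> E i - N" for a
        using less[of a] that endowment_const[OF i, of a] by (simp add: inner)
      show "p \<bullet> c i + \<delta> \<le> (\<Sum>j\<in>UNIV. p $ j * g a $ j)" if "a \<in> B \<delta> \<inter> E i" for a
        using that endowment_const[OF i, of a] by (simp add: B_def inner)
    qed (use \<delta> in \<open>auto simp: B_def\<close>)
    also have "\<dots> \<le> \<epsilon> * (\<Sum>j\<in>UNIV. \<Sum>k=1..K. \<mu> (L j k \<inter> E i))"
    proof (intro mult_left_mono sum_mono mono)
      fix j k
      have "{a\<in>S \<inter> E i - N. real k * \<epsilon> < p $ j * g a $ j}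
          = (S \<inter> E i - N) \<inter> {a\<in>space M. real k * \<epsilon> < p $ j * g a $ j}"
        using sets.sets_into_space[OF SM] by auto
      also have "\<dots> \<in> sets M" using DM gMj[of j] by measurable
      finally show "{a\<in>S \<inter> E i - N. real k * \<epsilon> < p $ j * g a $ j} \<in> sets M" .
      show "L j k \<inter> E i \<in> sets M" using LM parts_measurable[OF i] by auto
      show "{a\<in>S \<inter> E i - N. real k * \<epsilon> < p $ j * g a $ j} \<subseteq> L j k \<inter> E i"
        using sets.sets_into_space[OF SM] by (auto simp: L_def)
    qed (use \<epsilon> in simp)
    finally show ?thesis by (simp add: fuzzy_null_Diff[OF N SE[OF i]])
  qed
  have "p \<bullet> choquet_on M \<mu> e S = (\<Sum>j\<in>UNIV. \<Sum>i=1..r. p $ j * (c i $ j * \<mu> (S \<inter> E i)))"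
    by (simp add: inner_vec_def choquet_endowment[OF SM] sum_distrib_left)
  also have "\<dots> = (\<Sum>i=1..r. (p \<bullet> c i) * \<mu> (S \<inter> E i))"
    by (subst sum.swap) (simp add: inner_vec_def sum_distrib_right mult.assoc)
  finally have "p \<bullet> choquet_on M \<mu> e S = (\<Sum>i=1..r. (p \<bullet> c i) * \<mu> (S \<inter> E i))" .
  then have "p \<bullet> choquet_on M \<mu> e S - \<epsilon> * (n + 1) * \<mu> S + \<delta> * \<mu> (B \<delta>)
      = (\<Sum>i=1..r. (p \<bullet> c i - \<epsilon> * (n + 1)) * \<mu> (S \<inter> E i) + \<delta> * \<mu> (B \<delta> \<inter> E i))"
    by (simp add: additive_on_parts[OF SM] additive_on_parts[OF BM[of \<delta>]] left_diff_distrib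
        sum.distrib sum_subtractf sum_distrib_left)
  also have "\<dots> \<le> (\<Sum>i=1..r. \<epsilon> * (\<Sum>j\<in>UNIV. \<Sum>k=1..K. \<mu> (L j k \<inter> E i)))"
    by (rule sum_mono) (use lower in auto)
  \<comment> \<open>With the sum over the parts innermost, additivity reassembles each
    \<open>\<mu> (L j k)\<close>.\<close>
  also have "\<dots> = \<epsilon> * (\<Sum>j\<in>UNIV. \<Sum>k=1..K. \<Sum>i=1..r. \<mu> (L j k \<inter> E i))"
    unfolding sum_distrib_left[symmetric]
    by (subst sum.swap) (subst (2) sum.swap, rule refl)
  also have "\<dots> = (\<Sum>j\<in>UNIV. \<epsilon> * (\<Sum>k=1..K. \<mu> (L j k)))"
    unfolding additive_on_parts[OF LM, symmetric] by (rule sum_distrib_left)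
  also have "\<dots> \<le> p \<bullet> choquet_on M \<mu> g S"
    unfolding inner_vec_def by (rule sum_mono) (use upper in simp)
  finally have "p \<bullet> choquet_on M \<mu> e S - \<epsilon> * (n + 1) * \<mu> S + \<delta> * \<mu> (B \<delta>) \<le> p \<bullet> choquet_on M \<mu> g S" .
  moreover have "\<epsilon> * (n + 1) * \<mu> S = \<delta> * \<mu> (B \<delta>) / 2"
  proof -
    have cancel: "x / (2 * y * z) * y * z = x / 2" if "y \<noteq> 0" "z \<noteq> 0" for x y z :: real
      using that by simp
    then show ?thesis unfolding \<epsilon>_def using npos Spos by (intro cancel) auto
  qed
  moreover have "\<delta> * \<mu> (B \<delta>) > 0" using \<delta> Bpos by simp
  ultimately show ?thesis by linarith
qed

end

section \<open>Walrasian prices exclude improving coalitions\<close>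

theorem theorem3p2:
  fixes M :: "'a measure" and \<mu> :: "'a set \<Rightarrow> real"
    and r :: nat and E :: "nat \<Rightarrow> 'a set"
    and c :: "nat \<Rightarrow> real ^ 'n" and pref :: "nat \<Rightarrow> real ^ 'n \<Rightarrow> real ^ 'n \<Rightarrow> bool"
    and e :: "'a \<Rightarrow> real ^ 'n" and better :: "'a \<Rightarrow> real ^ 'n \<Rightarrow> real ^ 'n \<Rightarrow> bool"
  assumes "exchange_economy M \<mu> r E c pref e better"
  shows "walrasian M \<mu> e better \<subseteq> core M \<mu> e better"
proof
  interpret exchange_economy M \<mu> r E c pref e better by fact
  fix f assume f: "f \<in> walrasian M \<mu> e better"
  then obtain p N where p: "price p" and N: "fuzzy_null M \<mu> N"
    and walras: "\<And>a x. \<lbrakk>a \<in> space M - N; x \<in> nonneg_orthant; better a x (f a)\<rbrakk> \<Longrightarrow> p \<bullet> e a < p \<bullet> x"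
    by (auto simp: walrasian_def ae_in_def)
  have "\<not> improves M \<mu> e better S f" if S: "coalition M \<mu> S" for S
  proof
    assume "improves M \<mu> e better S f"
    then obtain g N' where g: "allocation M \<mu> g" and N': "fuzzy_null M \<mu> N'"
      and better: "\<And>a. a \<in> S - N' \<Longrightarrow> better a (g a) (f a)"
      and eq: "choquet_on M \<mu> g S = choquet_on M \<mu> e S"
      by (auto simp: improves_def ae_in_def)
    have "S \<subseteq> space M" using S sets.sets_into_space by (auto simp: coalition_def)
    \<comment> \<open>Off both exceptional sets \<open>g a\<close> is preferred to
      \<open>f a\<close>, so it costs more than the endowment.\<close>
    then have "p \<bullet> e a < p \<bullet> g a" if "a \<in> S - (N \<union> N')" for a
      using that g better by (intro walras) (auto simp: allocation_def)
    then have "ae_in M \<mu> S (\<lambda>a. p \<bullet> e a < p \<bullet> g a)"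
      unfolding ae_in_def using fuzzy_null_Un[OF N N'] by blast
    from value_less_of_dominates[OF g S _ this] show False
      using p eq by (simp add: price_def)
  qed
  then show "f \<in> core M \<mu> e better"
    using f by (auto simp: core_def walrasian_def)
qed

end
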